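(* The Lipschitz-free space $\mathcal{F}(\ell_1)$ admits a monotone finite-dimensional Schauder decomposition, and for every $N\in\mathbb{N}$ (with $N\geq 1$) the Lipschitz-free space $\mathcal{F}(\ell_1^N)$ admits a monotone finite-dimensional Schauder decomposition.
   Context: $\ell_1^N$ is $\mathbb{R}^N$ with the norm $\|x\|_1=\sum_{i=1}^N|x_i|$, and $\ell_1$ is the space of real sequences with $\|x\|_1=\sum_{i=1}^\infty|x_i|<\infty$; both are regarded as pointed metric spaces (with the norm metric) whose distinguished point is the origin. For a pointed metric space $(M,d)$ with distinguished point $0$, $\mathrm{Lip}_0(M)$ is the Banach space of all real-valued Lipschitz functions $f$ on $M$ with $f(0)=0$, with norm the Lipschitz constant $\mathrm{Lip}(f)$. For $p\in M$, $\delta(p)\in \mathrm{Lip}_0(M)^*$ is the evaluation $\langle g,\delta(p)\rangle=g(p)$. The Lipschitz-free space $\mathcal{F}(M)$ is the norm-closed linear span of $\{\delta(p):p\in M\}$ in $\mathrm{Lip}_0(M)^*$. A sequence $(X_n)_{n=1}^\infty$ of finite-dimensional subspaces of a Banach space $X$ is a finite-dimensional Schauder decomposition (FDD) of $X$ if every $x\in X$ has a unique representation $x=\sum_{n=1}^\infty x_n$ (norm convergent) with $x_n\in X_n$ for every $n\in\mathbb{N}$. The partial sum projections are $S_n\left(\sum_{k=1}^\infty x_k\right)=\sum_{k=1}^n x_k$; they are bounded uniformly in $n$ and $\sup_{n}\|S_n\|$ is the decomposition constant. The decomposition is monotone if its decomposition constant is $1$. *)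

theory Defs
  imports "HOL-Analysis.Analysis"
begin

text \<open>
  One type constructor covers both cases: \<^typ>\<open>nat\<close> as index type gives the sequence space
  \<open>\<ell>\<^sub>1\<close>, and a finite index type with \<open>N\<close> elements gives \<open>\<ell>\<^sub>1\<^sup>N\<close>; see \<open>l1_nat\<close> and
  \<open>l1_finite\<close> below.
\<close>

typedef 'i l1 = "{x :: 'i \<Rightarrow> real. (\<lambda>i. \<bar>x i\<bar>) summable_on UNIV}"
  morphisms l1_nth Abs_l1
  by (rule exI[of _ "\<lambda>_. 0"]) simp

setup_lifting type_definition_l1

lemma abs_summable_add:
  fixes x y :: "'i \<Rightarrow> real"
  assumes "(\<lambda>i. \<bar>x i\<bar>) summable_on UNIV" "(\<lambda>i. \<bar>y i\<bar>) summable_on UNIV"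
  shows "(\<lambda>i. \<bar>x i + y i\<bar>) summable_on UNIV"
  by (rule summable_on_comparison_test[OF summable_on_add[OF assms]])
     (auto simp: abs_triangle_ineq)

lemma abs_summable_scale:
  fixes x :: "'i \<Rightarrow> real"
  assumes "(\<lambda>i. \<bar>x i\<bar>) summable_on UNIV"
  shows "(\<lambda>i. \<bar>r * x i\<bar>) summable_on UNIV"
  using summable_on_cmult_right[OF assms, of "\<bar>r\<bar>"] by (simp add: abs_mult)

instantiation l1 :: (type) real_normed_vector
begin

lift_definition zero_l1 :: "'i l1" is "\<lambda>_. 0" by simp

lift_definition plus_l1 :: "'i l1 \<Rightarrow> 'i l1 \<Rightarrow> 'i l1" is "\<lambda>x y i. x i + y i"
  by (rule abs_summable_add)

lift_definition uminus_l1 :: "'i l1 \<Rightarrow> 'i l1" is "\<lambda>x i. - x i" by simp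

lift_definition minus_l1 :: "'i l1 \<Rightarrow> 'i l1 \<Rightarrow> 'i l1" is "\<lambda>x y i. x i - y i"
  subgoal for x y using abs_summable_add[of x "\<lambda>i. - y i"] by simp
  done

lift_definition scaleR_l1 :: "real \<Rightarrow> 'i l1 \<Rightarrow> 'i l1" is "\<lambda>r x i. r * x i"
  by (rule abs_summable_scale)

lift_definition norm_l1 :: "'i l1 \<Rightarrow> real" is "\<lambda>x. \<Sum>\<^sub>\<infinity>i\<in>UNIV. \<bar>x i\<bar>" .

definition dist_l1 :: "'i l1 \<Rightarrow> 'i l1 \<Rightarrow> real" where
  "dist_l1 x y = norm (x - y)"

definition sgn_l1 :: "'i l1 \<Rightarrow> 'i l1" where
  "sgn_l1 x = inverse (norm x) *\<^sub>R x"

definition uniformity_l1 :: "('i l1 \<times> 'i l1) filter" where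
  "uniformity_l1 = (INF e\<in>{0<..}. principal {(x, y). dist x y < e})"

definition open_l1 :: "'i l1 set \<Rightarrow> bool" where
  "open_l1 U \<longleftrightarrow> (\<forall>x\<in>U. eventually (\<lambda>(x', y). x' = x \<longrightarrow> y \<in> U) uniformity)"

instance
proof
  fix x y z :: "'i l1" and a b :: real
  show "x + y + z = x + (y + z)" "x + y = y + x" "0 + x = x" "- x + x = 0" "x - y = x + - y"
    by (transfer; simp add: fun_eq_iff)+
  show "a *\<^sub>R (x + y) = a *\<^sub>R x + a *\<^sub>R y" "(a + b) *\<^sub>R x = a *\<^sub>R x + b *\<^sub>R x"
    "a *\<^sub>R b *\<^sub>R x = (a * b) *\<^sub>R x" "1 *\<^sub>R x = x"
    by (transfer; simp add: fun_eq_iff algebra_simps)+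
  show "(norm x = 0) = (x = 0)"
  proof (transfer, safe)
    fix x :: "'i \<Rightarrow> real"
    assume s: "(\<lambda>i. \<bar>x i\<bar>) summable_on UNIV" and z: "(\<Sum>\<^sub>\<infinity>i. \<bar>x i\<bar>) = 0"
    have "\<bar>x i\<bar> = 0" for i
      by (rule nonneg_infsum_le_0D[of "\<lambda>i. \<bar>x i\<bar>" UNIV]) (use s z in auto)
    then show "x = (\<lambda>_. 0)" by auto
  qed simp
  show "norm (x + y) \<le> norm x + norm y"
  proof transfer
    fix x y :: "'i \<Rightarrow> real"
    assume s: "(\<lambda>i. \<bar>x i\<bar>) summable_on UNIV" "(\<lambda>i. \<bar>y i\<bar>) summable_on UNIV"
    have "(\<Sum>\<^sub>\<infinity>i. \<bar>x i + y i\<bar>) \<le> (\<Sum>\<^sub>\<infinity>i. \<bar>x i\<bar> + \<bar>y i\<bar>)"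
      by (rule infsum_mono[OF abs_summable_add[OF s] summable_on_add[OF s]])
         (rule abs_triangle_ineq)
    also have "\<dots> = (\<Sum>\<^sub>\<infinity>i. \<bar>x i\<bar>) + (\<Sum>\<^sub>\<infinity>i. \<bar>y i\<bar>)"
      by (rule infsum_add[OF s])
    finally show "(\<Sum>\<^sub>\<infinity>i. \<bar>x i + y i\<bar>) \<le> (\<Sum>\<^sub>\<infinity>i. \<bar>x i\<bar>) + (\<Sum>\<^sub>\<infinity>i. \<bar>y i\<bar>)" .
  qed
  show "norm (a *\<^sub>R x) = \<bar>a\<bar> * norm x"
    by transfer (simp add: abs_mult infsum_cmult_right')
qed (simp_all add: dist_l1_def sgn_l1_def uniformity_l1_def open_l1_def)

end

lemma l1_nat:
  "range (l1_nth :: nat l1 \<Rightarrow> nat \<Rightarrow> real) = {x. summable (\<lambda>i. \<bar>x i\<bar>)}"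
  "norm (z :: nat l1) = (\<Sum>i. \<bar>l1_nth z i\<bar>)"
proof -
  have eq: "(\<lambda>i. \<bar>x i\<bar>) summable_on UNIV \<longleftrightarrow> summable (\<lambda>i. \<bar>x i\<bar>)" for x :: "nat \<Rightarrow> real"
    by (rule summable_on_UNIV_nonneg_real_iff) simp
  show "range (l1_nth :: nat l1 \<Rightarrow> nat \<Rightarrow> real) = {x. summable (\<lambda>i. \<bar>x i\<bar>)}"
    by (simp add: type_definition.Rep_range[OF type_definition_l1] eq)
  have "((\<lambda>i. \<bar>l1_nth z i\<bar>) has_sum norm z) UNIV"
    using l1_nth[of z] by (simp add: norm_l1.rep_eq)
  then show "norm z = (\<Sum>i. \<bar>l1_nth z i\<bar>)"
    by (intro sums_unique has_sum_imp_sums)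
qed

lemma l1_finite:
  "range (l1_nth :: 'n::finite l1 \<Rightarrow> 'n \<Rightarrow> real) = UNIV"
  "norm (w :: 'n::finite l1) = (\<Sum>i\<in>UNIV. \<bar>l1_nth w i\<bar>)"
  by (simp_all add: type_definition.Rep_range[OF type_definition_l1] norm_l1.rep_eq)

text \<open>A pointed metric space is a metric type with distinguished point \<open>0\<close>.\<close>

typedef (overloaded) 'a lip0 =
  "{f :: 'a::{metric_space, zero} \<Rightarrow> real. f 0 = 0 \<and> (\<exists>L. L-lipschitz_on UNIV f)}"
  morphisms lip0_apply Abs_lip0
  by (rule exI[of _ "\<lambda>_. 0"]) (auto intro!: exI[of _ 0] lipschitz_onI)

setup_lifting type_definition_lip0

text \<open>
  The least Lipschitz constant. Pairs with \<open>x = y\<close> contribute \<open>0 / 0 = 0\<close>; they only keep the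
  supremum from being taken over the empty set when the metric space is a singleton.
\<close>

definition lip_const :: "('a::metric_space \<Rightarrow> real) \<Rightarrow> real" where
  "lip_const f = (SUP (x, y). \<bar>f x - f y\<bar> / dist x y)"

lemma lip_const_bdd:
  assumes "L-lipschitz_on UNIV f"
  shows "bdd_above (range (\<lambda>(x, y). \<bar>f x - f y\<bar> / dist x y))"
    and "lip_const f \<le> L"
proof -
  have *: "\<bar>f x - f y\<bar> / dist x y \<le> L" for x y
  proof (cases "x = y")
    case True
    then show ?thesis using lipschitz_on_nonneg[OF assms] by simp
  next
    case False
    then show ?thesis
      using lipschitz_onD[OF assms, of x y] by (simp add: dist_real_def divide_le_eq)
  qed
  show "bdd_above (range (\<lambda>(x, y). \<bar>f x - f y\<bar> / dist x y))"
    by (rule bdd_aboveI[of _ L]) (use * in auto)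
  show "lip_const f \<le> L"
    unfolding lip_const_def by (rule cSUP_least) (use * in auto)
qed

lemma lip_const_lipschitz:
  assumes "L-lipschitz_on UNIV f"
  shows "(lip_const f)-lipschitz_on UNIV f"
proof -
  have *: "\<bar>f x - f y\<bar> / dist x y \<le> lip_const f" for x y
    unfolding lip_const_def using cSUP_upper[OF _ lip_const_bdd(1)[OF assms], of "(x, y)"] by simp
  show ?thesis
  proof (rule lipschitz_onI)
    show "0 \<le> lip_const f" using *[of undefined undefined] by simp
    show "dist (f x) (f y) \<le> lip_const f * dist x y" for x y
      using *[of x y] by (cases "x = y") (auto simp: dist_real_def divide_le_eq)
  qed
qed

instantiation lip0 :: ("{metric_space, zero}") real_normed_vector
begin

lift_definition zero_lip0 :: "'a lip0" is "\<lambda>_. 0"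
  by (auto intro!: exI[of _ 0] lipschitz_onI)

lift_definition plus_lip0 :: "'a lip0 \<Rightarrow> 'a lip0 \<Rightarrow> 'a lip0" is "\<lambda>f g x. f x + g x"
  by (auto intro: lipschitz_on_add)

lift_definition uminus_lip0 :: "'a lip0 \<Rightarrow> 'a lip0" is "\<lambda>f x. - f x"
  by (auto simp: lipschitz_on_minus_iff)

lift_definition minus_lip0 :: "'a lip0 \<Rightarrow> 'a lip0 \<Rightarrow> 'a lip0" is "\<lambda>f g x. f x - g x"
  by (auto intro: lipschitz_on_diff)

lift_definition scaleR_lip0 :: "real \<Rightarrow> 'a lip0 \<Rightarrow> 'a lip0" is "\<lambda>r f x. r * f x"
  by (auto intro: lipschitz_on_cmult_real)

lift_definition norm_lip0 :: "'a lip0 \<Rightarrow> real" is lip_const .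

definition dist_lip0 :: "'a lip0 \<Rightarrow> 'a lip0 \<Rightarrow> real" where
  "dist_lip0 f g = norm (f - g)"

definition sgn_lip0 :: "'a lip0 \<Rightarrow> 'a lip0" where
  "sgn_lip0 f = inverse (norm f) *\<^sub>R f"

definition uniformity_lip0 :: "('a lip0 \<times> 'a lip0) filter" where
  "uniformity_lip0 = (INF e\<in>{0<..}. principal {(f, g). dist f g < e})"

definition open_lip0 :: "'a lip0 set \<Rightarrow> bool" where
  "open_lip0 U \<longleftrightarrow> (\<forall>f\<in>U. eventually (\<lambda>(f', g). f' = f \<longrightarrow> g \<in> U) uniformity)"

instance
proof
  fix f g h :: "'a lip0" and a b :: real
  show "f + g + h = f + (g + h)" "f + g = g + f" "0 + f = f" "- f + f = 0" "f - g = f + - g"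
    by (transfer; simp add: fun_eq_iff)+
  show "a *\<^sub>R (f + g) = a *\<^sub>R f + a *\<^sub>R g" "(a + b) *\<^sub>R f = a *\<^sub>R f + b *\<^sub>R f"
    "a *\<^sub>R b *\<^sub>R f = (a * b) *\<^sub>R f" "1 *\<^sub>R f = f"
    by (transfer; simp add: fun_eq_iff algebra_simps)+
  show "(norm f = 0) = (f = 0)"
  proof (transfer, safe)
    fix f :: "'a \<Rightarrow> real" and L
    assume f0: "f 0 = 0" and "L-lipschitz_on UNIV f" and "lip_const f = 0"
    then have "0-lipschitz_on UNIV f" using lip_const_lipschitz by metis
    from lipschitz_onD[OF this, of _ 0] show "f = (\<lambda>_. 0)" by (auto simp: f0)
  next
    show "lip_const (\<lambda>_::'a. 0) = 0" by (simp add: lip_const_def case_prod_unfold)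
  qed
  show "norm (f + g) \<le> norm f + norm g"
  proof transfer
    fix f g :: "'a \<Rightarrow> real"
    assume "f 0 = 0 \<and> (\<exists>L. L-lipschitz_on UNIV f)" "g 0 = 0 \<and> (\<exists>L. L-lipschitz_on UNIV g)"
    then show "lip_const (\<lambda>x. f x + g x) \<le> lip_const f + lip_const g"
      by (blast intro: lip_const_bdd(2) lipschitz_on_add lip_const_lipschitz)
  qed
  have le: "norm (r *\<^sub>R k) \<le> \<bar>r\<bar> * norm k" for r and k :: "'a lip0"
  proof transfer
    fix r and f :: "'a \<Rightarrow> real"
    assume "f 0 = 0 \<and> (\<exists>L. L-lipschitz_on UNIV f)"
    then show "lip_const (\<lambda>x. r * f x) \<le> \<bar>r\<bar> * lip_const f"
      by (blast intro: lip_const_bdd(2) lipschitz_on_cmult_real lip_const_lipschitz)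
  qed
  show "norm (a *\<^sub>R f) = \<bar>a\<bar> * norm f"
  proof (cases "a = 0")
    case True
    then show ?thesis using le[of 0 f] le[of 0 "0 *\<^sub>R f"]
      by (transfer) (simp add: lip_const_def case_prod_unfold)
  next
    case False
    have "inverse a *\<^sub>R (a *\<^sub>R f) = f"
      using False by (transfer) (simp add: fun_eq_iff field_simps)
    then have "norm f \<le> \<bar>inverse a\<bar> * norm (a *\<^sub>R f)" using le[of "inverse a" "a *\<^sub>R f"] by simp
    then have "\<bar>a\<bar> * norm f \<le> norm (a *\<^sub>R f)" using False by (simp add: field_simps)
    with le[of a f] show ?thesis by simp
  qed
qed (simp_all add: dist_lip0_def sgn_lip0_def uniformity_lip0_def open_lip0_def)

end

lift_definition lip_eval :: "'a::{metric_space, zero} \<Rightarrow> 'a lip0 \<Rightarrow>\<^sub>L real"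
  is "\<lambda>p g. lip0_apply g p"
proof (rule bounded_linear_intro)
  fix p :: 'a and f g :: "'a lip0" and r :: real
  show "lip0_apply (f + g) p = lip0_apply f p + lip0_apply g p"
    by (simp add: plus_lip0.rep_eq)
  show "lip0_apply (r *\<^sub>R f) p = r *\<^sub>R lip0_apply f p"
    by (simp add: scaleR_lip0.rep_eq)
  from lip0_apply[of f] obtain L where f0: "lip0_apply f 0 = 0"
    and "L-lipschitz_on UNIV (lip0_apply f)" by auto
  from lipschitz_onD[OF lip_const_lipschitz[OF this(2)], of p 0]
  show "norm (lip0_apply f p) \<le> norm f * dist p 0"
    by (simp add: norm_lip0.rep_eq f0)
qed

text \<open>The bounded linear functionals carry the operator norm, so this is a closed subspace of the
  dual of the space of Lipschitz functions.\<close>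

definition lipschitz_free :: "('a::{metric_space, zero} lip0 \<Rightarrow>\<^sub>L real) set" where
  "lipschitz_free = closure (span (range lip_eval))"

lemma lip_eval_apply: "blinfun_apply (lip_eval p) g = lip0_apply g p"
  by (rule lip_eval.rep_eq[THEN fun_cong])

lemma closed_lipschitz_free: "closed lipschitz_free"
  by (simp add: lipschitz_free_def)

lemma subspace_lipschitz_free:
  "subspace (lipschitz_free :: ('a::{metric_space, zero} lip0 \<Rightarrow>\<^sub>L real) set)"
  unfolding lipschitz_free_def subspace_def
proof (intro conjI ballI allI)
  let ?S = "span (range (lip_eval :: 'a \<Rightarrow> _))"
  show "0 \<in> closure ?S"
    using closure_subset span_zero by blast
  fix x assume "x \<in> closure ?S"
  then obtain u where u: "\<And>n. u n \<in> ?S" "u \<longlonglongrightarrow> x"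
    unfolding closure_sequential by blast
  show "r *\<^sub>R x \<in> closure ?S" for r
    unfolding closure_sequential using u
    by (intro exI[of _ "\<lambda>n. r *\<^sub>R u n"]) (auto intro: span_scale tendsto_intros)
  fix y assume "y \<in> closure ?S"
  then obtain v where v: "\<And>n. v n \<in> ?S" "v \<longlonglongrightarrow> y"
    unfolding closure_sequential by blast
  show "x + y \<in> closure ?S"
    unfolding closure_sequential using u v
    by (intro exI[of _ "\<lambda>n. u n + v n"]) (auto intro: span_add tendsto_intros)
qed

text \<open>A Banach space is given as a closed subspace \<open>X\<close> of a Banach space type, with the inherited
  norm. The summands are indexed from \<open>0\<close>.\<close>

definition is_FDD :: "'b::banach set \<Rightarrow> (nat \<Rightarrow> 'b set) \<Rightarrow> bool" where
  "is_FDD X E \<longleftrightarrow>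
     closed X \<and> subspace X \<and>
     (\<forall>n. subspace (E n) \<and> E n \<subseteq> X \<and> (\<exists>B. finite B \<and> E n = span B)) \<and>
     (\<forall>x\<in>X. \<exists>!u. (\<forall>n. u n \<in> E n) \<and> u sums x)"

definition FDD_components :: "(nat \<Rightarrow> 'b::banach set) \<Rightarrow> 'b \<Rightarrow> nat \<Rightarrow> 'b" where
  "FDD_components E x = (THE u. (\<forall>n. u n \<in> E n) \<and> u sums x)"

definition FDD_proj :: "(nat \<Rightarrow> 'b::banach set) \<Rightarrow> nat \<Rightarrow> 'b \<Rightarrow> 'b" where
  "FDD_proj E n x = (\<Sum>k\<le>n. FDD_components E x k)"

text \<open>The supremum of the operator norms of the partial sum projections as operators on \<open>X\<close>, taken
  in the extended nonnegative reals so that it is meaningful without a boundedness proof.\<close>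

definition decomposition_constant :: "'b::banach set \<Rightarrow> (nat \<Rightarrow> 'b set) \<Rightarrow> ennreal" where
  "decomposition_constant X E = (SUP n. SUP x\<in>X \<inter> cball 0 1. ennreal (norm (FDD_proj E n x)))"

definition admits_monotone_FDD :: "'b::banach set \<Rightarrow> bool" where
  "admits_monotone_FDD X \<longleftrightarrow> (\<exists>E. is_FDD X E \<and> decomposition_constant X E = 1)"

end

theory Submission
  imports Defs
begin

text \<open>
  On Lipschitz functions let \<open>T n f\<close> be the multi-affine interpolation of \<open>f\<close> from the grid of mesh
  \<open>2\<^sup>-\<^sup>n\<close> in the cube \<open>[-2\<^sup>n, 2\<^sup>n]\<^sup>A\<close>, where \<open>A\<close> is the \<open>n\<close>-th member of an exhausting sequence
  of finite sets of coordinates and points are first projected to the coordinates in \<open>A\<close> and clamped to the cube.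
  On a cell of the grid the partial derivative of a multi-affine interpolation is a convex
  combination of difference quotients of \<open>f\<close> along parallel edges; since the norm is the \<open>\<ell>\<^sub>1\<close> norm,
  \<open>T n\<close> does not increase the Lipschitz constant. As the grids are nested and a function that is
  affine in each coordinate on coarse cells is so on finer ones, \<open>T m (T n f) = T (min m n) f\<close>.
  The adjoints of the \<open>T n\<close> are therefore commuting finite-rank contractions on the free space, and
  they converge strongly to the identity because they do so on evaluations.
\<close>

section \<open>Decompositions from commuting projections\<close>

lemma subspace_of_finite_span:
  fixes V :: "'b::real_vector set"
  assumes "subspace V" "V \<subseteq> span B" "finite B"
  shows "\<exists>C. finite C \<and> V = span C"
proof -
  obtain C where C: "C \<subseteq> V" "independent C" "V \<subseteq> span C"
    by (rule basis_exists)
  have "finite C"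
    using independent_span_bound[OF \<open>finite B\<close> C(2)] C(1) assms(2) by blast
  moreover have "span C \<subseteq> V"
    using C(1) assms(1) by (rule span_minimal)
  ultimately show ?thesis using C(3) by blast
qed

text \<open>The summands are the ranges of the differences \<open>D n = S n - S (n - 1)\<close>. By
  \<open>comm\<close> these are projections that annihilate each other, their partial sums are the
  contractions \<open>S n\<close>, and \<open>lim\<close> says that the resulting series converges
  to \<open>x\<close>.\<close>

lemma monotone_FDD_of_commuting_projections:
  fixes X :: "'b::banach set" and S :: "nat \<Rightarrow> 'b \<Rightarrow>\<^sub>L 'b"
  assumes X: "closed X" "subspace X" "X \<noteq> {0}"
    and SX: "\<And>n x. x \<in> X \<Longrightarrow> blinfun_apply (S n) x \<in> X"
    and fin: "\<And>n. \<exists>B. finite B \<and> blinfun_apply (S n) ` X \<subseteq> span B"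
    and contr: "\<And>n x. x \<in> X \<Longrightarrow> norm (blinfun_apply (S n) x) \<le> norm x"
    and comm: "\<And>m n x. x \<in> X \<Longrightarrow>
      blinfun_apply (S m) (blinfun_apply (S n) x) = blinfun_apply (S (min m n)) x"
    and lim: "\<And>x. x \<in> X \<Longrightarrow> (\<lambda>n. blinfun_apply (S n) x) \<longlonglongrightarrow> x"
  shows "admits_monotone_FDD X"
proof -
  define D where "D n = (case n of 0 \<Rightarrow> S 0 | Suc k \<Rightarrow> S (Suc k) - S k)" for n
  define E where "E n = blinfun_apply (D n) ` X" for n
  have D0: "blinfun_apply (D 0) x = blinfun_apply (S 0) x"
    and DS: "blinfun_apply (D (Suc k)) x = blinfun_apply (S (Suc k)) x - blinfun_apply (S k) x"
    for k x by (simp_all add: D_def blinfun.diff_left)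
  have partial: "(\<Sum>k\<le>n. blinfun_apply (D k) x) = blinfun_apply (S n) x" for n x
    by (induction n) (simp_all add: D0 DS)
  have DX: "blinfun_apply (D n) x \<in> X" if "x \<in> X" for n x
    by (cases n) (auto simp: D0 DS intro: SX that subspace_diff[OF X(2)])
  have SS: "blinfun_apply (S m) (blinfun_apply (S n) x) = blinfun_apply (S m) x"
    "blinfun_apply (S n) (blinfun_apply (S m) x) = blinfun_apply (S m) x"
    if "x \<in> X" "m \<le> n" for m n x
    using comm[OF that(1), of m n] comm[OF that(1), of n m] that(2) by (simp_all add: min_def)
  have DD: "blinfun_apply (D m) (blinfun_apply (D n) x)
      = (if m = n then blinfun_apply (D n) x else 0)" if "x \<in> X" for m n x
  proof (cases m n rule: linorder_cases)
    case equal
    then show ?thesis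
      by (cases n) (simp_all add: D0 DS blinfun.diff_right SS that)
  next
    case less
    then show ?thesis
      by (cases m; cases n) (simp_all add: D0 DS blinfun.diff_right SS that)
  next
    case greater
    then show ?thesis
      by (cases m; cases n) (simp_all add: D0 DS blinfun.diff_right SS that)
  qed
  have sums: "(\<lambda>n. blinfun_apply (D n) x) sums x" if "x \<in> X" for x
    using lim[OF that] by (simp add: sums_def_le partial)
  \<comment> \<open>The continuous map \<open>D m\<close> acts termwise on the series and kills
    every term but the \<open>m\<close>-th, so \<open>u m\<close> is forced.\<close>
  have unique: "u = (\<lambda>n. blinfun_apply (D n) x)"
    if u: "\<forall>n. u n \<in> E n" "u sums x" for u x
  proof
    fix m
    have "(\<lambda>n. blinfun_apply (D m) (u n)) sums blinfun_apply (D m) x"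
      using blinfun.bounded_linear_right u(2) by (rule bounded_linear.sums)
    moreover have "(\<lambda>n. blinfun_apply (D m) (u n)) = (\<lambda>n. if n = m then u m else 0)"
    proof
      fix n
      obtain y where "y \<in> X" "u n = blinfun_apply (D n) y"
        using u(1) unfolding E_def by blast
      then show "blinfun_apply (D m) (u n) = (if n = m then u m else 0)"
        using DD[of y m n] by auto
    qed
    ultimately have "(\<lambda>n. if n = m then u m else 0) sums blinfun_apply (D m) x"
      by simp
    with sums_single[of m "\<lambda>_. u m"] show "u m = blinfun_apply (D m) x"
      by (rule sums_unique2)
  qed
  have sub: "subspace (E n)" for n
    unfolding E_def
    by (rule linear_subspace_image[OF bounded_linear.linear[OF blinfun.bounded_linear_right] X(2)])
  have E_fin: "\<exists>C. finite C \<and> E n = span C" for n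
  proof -
    obtain B where B: "finite B" "blinfun_apply (S n) ` X \<subseteq> span B" using fin by blast
    \<comment> \<open>At \<open>n = 0\<close> the truncated \<open>n - 1\<close> is
      \<open>0\<close>, which is harmless because \<open>D 0\<close> involves \<open>S 0\<close>
      alone.\<close>
    obtain B' where B': "finite B'" "blinfun_apply (S (n - 1)) ` X \<subseteq> span B'" using fin by blast
    have "span B \<subseteq> span (B \<union> B')" "span B' \<subseteq> span (B \<union> B')"
      by (auto intro!: span_mono)
    then have in_span: "blinfun_apply (S n) x \<in> span (B \<union> B')"
      "blinfun_apply (S (n - 1)) x \<in> span (B \<union> B')"
      if "x \<in> X" for x using B(2) B'(2) that by blast+
    have "E n \<subseteq> span (B \<union> B')"
      unfolding E_def using in_span by (cases n) (auto simp: D0 DS intro: span_diff)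
    from subspace_of_finite_span[OF sub this] B(1) B'(1) show ?thesis by simp
  qed
  have ex1: "\<exists>!u. (\<forall>n. u n \<in> E n) \<and> u sums x" if "x \<in> X" for x
    using unique sums[OF that] that by (intro ex1I[of _ "\<lambda>n. blinfun_apply (D n) x"]) (auto simp: E_def)
  have FDD: "is_FDD X E"
    unfolding is_FDD_def using X sub E_fin ex1 DX by (auto simp: E_def)
  have comp: "FDD_components E x = (\<lambda>n. blinfun_apply (D n) x)" if "x \<in> X" for x
    unfolding FDD_components_def using sums[OF that] that
    by (intro the_equality unique) (auto simp: E_def)
  have proj: "FDD_proj E n x = blinfun_apply (S n) x" if "x \<in> X" for n x
    by (simp add: FDD_proj_def comp that partial)
  have le: "decomposition_constant X E \<le> 1"
    unfolding decomposition_constant_def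
  proof (intro SUP_least)
    fix n x assume "x \<in> X \<inter> cball 0 1"
    then show "ennreal (norm (FDD_proj E n x)) \<le> 1"
      using contr[of x n] proj[of x n] by (simp add: ennreal_le_1)
  qed
  \<comment> \<open>The lower bound uses a unit vector \<open>x\<close>: the norms of
    \<open>S n x\<close> tend to 1, and each is at most the decomposition constant.\<close>
  obtain x0 where x0: "x0 \<in> X" "x0 \<noteq> 0"
    using X(3) subspace_0[OF X(2)] by blast
  define x where "x = (1 / norm x0) *\<^sub>R x0"
  have x: "x \<in> X" "norm x = 1"
    using x0 subspace_scale[OF X(2)] by (auto simp: x_def)
  have "(\<lambda>n. ennreal (norm (blinfun_apply (S n) x))) \<longlonglongrightarrow> ennreal (norm x)"
    by (intro tendsto_ennrealI tendsto_norm lim x)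
  moreover have "ennreal (norm (blinfun_apply (S n) x)) \<le> decomposition_constant X E" for n
    unfolding decomposition_constant_def using x
    by (intro SUP_upper2[of n] SUP_upper2[of x]) (auto simp: proj)
  ultimately have "ennreal (norm x) \<le> decomposition_constant X E"
    using LIMSEQ_le_const2 by blast
  with le FDD x show ?thesis
    unfolding admits_monotone_FDD_def by (intro exI[of _ E]) simp
qed

section \<open>Interpolation operators on pointed metric spaces\<close>

lemma lip0_lipschitz: "(norm f)-lipschitz_on UNIV (lip0_apply f)"
  using lip0_apply[of f] lip_const_lipschitz by (auto simp: norm_lip0.rep_eq)

lemma norm_lip0_le: "L-lipschitz_on UNIV (lip0_apply f) \<Longrightarrow> norm f \<le> L"
  by (simp add: norm_lip0.rep_eq lip_const_bdd(2))

lemma lip0_apply_0: "lip0_apply f 0 = 0"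
  using lip0_apply[of f] by auto

lemma lip0_eqI: "(\<And>x. lip0_apply f x = lip0_apply g x) \<Longrightarrow> f = g"
  by (simp add: fun_eq_iff flip: lip0_apply_inject)

lemma lip0_bump:
  fixes G :: "'a::{metric_space, zero} set"
  assumes "finite G" "p \<noteq> 0"
  shows "\<exists>g :: 'a lip0. \<forall>q\<in>G. lip0_apply g q = (if q = p then 1 else 0)"
proof -
  \<comment> \<open>The bump is a tent at \<open>p\<close> of height 1 and radius \<open>d\<close>.
    Inserting \<open>0\<close> makes it vanish at the base point as well, as membership in
    \<open>lip0\<close> requires.\<close>
  obtain d where d: "d > 0" "\<And>q. q \<in> insert 0 G \<Longrightarrow> q \<noteq> p \<Longrightarrow> d \<le> dist p q"
    using finite_set_avoid[of "insert 0 G" p] assms(1) by auto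
  define h where "h = (\<lambda>x. max 0 (1 - dist p x / d))"
  have far: "h q = 0" if "q \<in> insert 0 G" "q \<noteq> p" for q
    using d(1) d(2)[OF that] by (simp add: h_def)
  have "(1 / d)-lipschitz_on UNIV h"
  proof (rule lipschitz_onI)
    fix x y
    have "\<bar>h x - h y\<bar> \<le> \<bar>dist p x / d - dist p y / d\<bar>"
      unfolding h_def by linarith
    also have "\<dots> = \<bar>dist p x - dist p y\<bar> / d"
      using d(1) by (simp flip: diff_divide_distrib)
    also have "\<dots> \<le> dist x y / d"
      using d(1) abs_dist_diff_le[of x p y] by (simp add: divide_right_mono dist_commute)
    finally show "dist (h x) (h y) \<le> 1 / d * dist x y"
      by (simp add: dist_real_def)
  qed (use d in simp)
  then have "lip0_apply (Abs_lip0 h) = h"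
    using far[of 0] assms(2) by (auto intro!: Abs_lip0_inverse)
  moreover have "h p = 1" by (simp add: h_def)
  ultimately show ?thesis using far by (intro exI[of _ "Abs_lip0 h"]) auto
qed

text \<open>Abstractly, \<open>T n\<close> interpolates at the finite node set \<open>G n\<close>,
  and \<open>c n y\<close> bounds its error at \<open>y\<close> per unit of Lipschitz constant.
  \<open>T_near\<close> is only eventual because a bounded grid says nothing about points far
  outside it.\<close>

locale lipschitz_projections =
  fixes T :: "nat \<Rightarrow> ('a::{metric_space, zero} \<Rightarrow> real) \<Rightarrow> 'a \<Rightarrow> real"
    and G :: "nat \<Rightarrow> 'a set" and c :: "nat \<Rightarrow> 'a \<Rightarrow> real"
  assumes T_add: "T n (\<lambda>x. f x + g x) y = T n f y + T n g y"
    and T_cmult: "T n (\<lambda>x. r * f x) y = r * T n f y"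
    and T_lipschitz: "L-lipschitz_on UNIV f \<Longrightarrow> L-lipschitz_on UNIV (T n f)"
    and finite_G: "finite (G n)"
    and zero_in_G: "0 \<in> G n"
    and G_mono: "m \<le> n \<Longrightarrow> G m \<subseteq> G n"
    and T_cong: "(\<And>p. p \<in> G n \<Longrightarrow> f p = g p) \<Longrightarrow> T n f y = T n g y"
    and T_on_G: "p \<in> G n \<Longrightarrow> T n f p = f p"
    and T_T: "m \<le> n \<Longrightarrow> T n (T m f) y = T m f y"
    and T_near: "\<forall>\<^sub>F n in sequentially. \<forall>L f. L-lipschitz_on UNIV f \<longrightarrow> \<bar>T n f y - f y\<bar> \<le> L * c n y"
    and c_tendsto: "(\<lambda>n. c n y) \<longlonglongrightarrow> 0"
begin

section \<open>Interpolation as an operator on Lipschitz functions, and its adjoint\<close>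

definition T_lip0 :: "nat \<Rightarrow> 'a lip0 \<Rightarrow>\<^sub>L 'a lip0" where
  "T_lip0 n = Blinfun (\<lambda>f. Abs_lip0 (T n (lip0_apply f)))"

lemma T_lip0_apply: "lip0_apply (blinfun_apply (T_lip0 n) f) = T n (lip0_apply f)"
  and norm_T_lip0_le: "norm (T_lip0 n) \<le> 1"
proof -
  let ?U = "\<lambda>f. Abs_lip0 (T n (lip0_apply f))"
  have U: "lip0_apply (?U f) = T n (lip0_apply f)" for f
    using T_lipschitz[OF lip0_lipschitz] T_on_G[OF zero_in_G]
    by (auto intro!: Abs_lip0_inverse simp: lip0_apply_0)
  have bound: "norm (?U f) \<le> norm f * 1" for f
    using norm_lip0_le[of "norm f" "?U f"] T_lipschitz[OF lip0_lipschitz] U by simp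
  have bl: "bounded_linear ?U"
  proof (rule bounded_linear_intro)
    show "?U (f + g) = ?U f + ?U g" for f g
      by (rule lip0_eqI) (simp only: plus_lip0.rep_eq[of "?U f"] U, simp add: plus_lip0.rep_eq T_add)
    show "?U (r *\<^sub>R f) = r *\<^sub>R ?U f" for r f
      by (rule lip0_eqI) (simp only: scaleR_lip0.rep_eq[of r "?U f"] U, simp add: scaleR_lip0.rep_eq T_cmult)
  qed (rule bound)
  have app: "blinfun_apply (T_lip0 n) = ?U"
    unfolding T_lip0_def by (rule bounded_linear_Blinfun_apply[OF bl])
  show "lip0_apply (blinfun_apply (T_lip0 n) f) = T n (lip0_apply f)"
    by (simp add: app U)
  show "norm (T_lip0 n) \<le> 1"
    by (rule norm_blinfun_bound) (use bound in \<open>simp_all add: app\<close>)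
qed

lemma T_lip0_T_lip0: "T_lip0 n o\<^sub>L T_lip0 m = T_lip0 (min m n)"
proof (intro blinfun_eqI lip0_eqI)
  fix f x
  have "T n (T m (lip0_apply f)) x = T (min m n) (lip0_apply f) x"
  proof (cases "m \<le> n")
    case False
    \<comment> \<open>Here \<open>n < m\<close>: the coarse nodes \<open>G n\<close> lie in
      \<open>G m\<close>, where \<open>T m f\<close> agrees with \<open>f\<close>, and
      \<open>T n\<close> sees only values at coarse nodes.\<close>
    then have "T n (T m (lip0_apply f)) x = T n (lip0_apply f) x"
      by (intro T_cong) (meson T_on_G G_mono nat_le_linear subsetD)
    then show ?thesis using False by simp
  qed (simp add: T_T)
  then show "lip0_apply (blinfun_apply (T_lip0 n o\<^sub>L T_lip0 m) f) x
      = lip0_apply (blinfun_apply (T_lip0 (min m n)) f) x"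
    by (simp add: T_lip0_apply)
qed

definition T_adj :: "nat \<Rightarrow> ('a lip0 \<Rightarrow>\<^sub>L real) \<Rightarrow>\<^sub>L ('a lip0 \<Rightarrow>\<^sub>L real)" where
  "T_adj n = Blinfun (\<lambda>\<mu>. \<mu> o\<^sub>L T_lip0 n)"

lemma T_adj_apply: "blinfun_apply (T_adj n) \<mu> = \<mu> o\<^sub>L T_lip0 n"
  unfolding T_adj_def
  by (subst bounded_linear_Blinfun_apply)
     (rule bounded_bilinear.bounded_linear_left[OF bounded_bilinear_blinfun_compose], rule refl)

lemma norm_T_adj_le: "norm (blinfun_apply (T_adj n) \<mu>) \<le> norm \<mu>"
  using norm_blinfun_compose[of \<mu> "T_lip0 n"] mult_left_mono[OF norm_T_lip0_le[of n], of "norm \<mu>"]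
  by (simp add: T_adj_apply)

lemma T_adj_T_adj: "blinfun_apply (T_adj m) (blinfun_apply (T_adj n) \<mu>) = blinfun_apply (T_adj (min m n)) \<mu>"
  by (rule blinfun_eqI) (simp add: T_adj_apply flip: T_lip0_T_lip0)

text \<open>\<open>T n f\<close> only depends on the finitely many values of \<open>f\<close> on \<open>G n\<close>, so \<open>f\<close> may be replaced by a
  combination of bump functions there.\<close>

lemma T_adj_in_span: "blinfun_apply (T_adj n) \<mu> \<in> span (lip_eval ` G n)"
proof -
  \<comment> \<open>The base point is left out: a member of \<open>lip0\<close> cannot be 1 there,
    and \<open>f\<close> vanishes there anyway.\<close>
  have "\<forall>p\<in>G n - {0}. \<exists>g :: 'a lip0. \<forall>q\<in>G n. lip0_apply g q = (if q = p then 1 else 0)"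
    using lip0_bump[OF finite_G] by blast
  then obtain b :: "'a \<Rightarrow> 'a lip0"
    where b: "\<And>p q. p \<in> G n - {0} \<Longrightarrow> q \<in> G n \<Longrightarrow> lip0_apply (b p) q = (if q = p then 1 else 0)"
    by metis
  have "blinfun_apply (T_adj n) \<mu>
      = (\<Sum>p\<in>G n - {0}. blinfun_apply \<mu> (blinfun_apply (T_lip0 n) (b p)) *\<^sub>R lip_eval p)"
  proof (rule blinfun_eqI)
    fix f
    let ?h = "\<Sum>p\<in>G n - {0}. lip0_apply f p *\<^sub>R b p"
    have "lip0_apply ?h q = lip0_apply f q" if "q \<in> G n" for q
    proof -
      have "lip0_apply ?h q = (\<Sum>p\<in>G n - {0}. lip0_apply f p * lip0_apply (b p) q)"
        \<comment> \<open>Evaluation at \<open>q\<close> passes through the sum once it is read as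
          the linear functional \<open>lip_eval q\<close>.\<close>
        by (simp add: blinfun.sum_right scaleR_lip0.rep_eq flip: lip_eval_apply)
           (simp add: lip_eval_apply scaleR_lip0.rep_eq)
      also have "\<dots> = (\<Sum>p\<in>G n - {0}. if p = q then lip0_apply f p else 0)"
        by (rule sum.cong) (auto simp: b that)
      also have "\<dots> = lip0_apply f q"
        using that finite_G by (auto simp: lip0_apply_0)
      finally show ?thesis .
    qed
    then have "blinfun_apply (T_lip0 n) f = blinfun_apply (T_lip0 n) ?h"
      by (intro lip0_eqI) (auto simp: T_lip0_apply intro!: T_cong)
    then show "blinfun_apply (blinfun_apply (T_adj n) \<mu>) f
      = blinfun_apply (\<Sum>p\<in>G n - {0}. blinfun_apply \<mu> (blinfun_apply (T_lip0 n) (b p)) *\<^sub>R lip_eval p) f"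
      by (simp add: T_adj_apply blinfun.sum_right blinfun.sum_left blinfun.scaleR_right
        blinfun.scaleR_left lip_eval_apply mult.commute)
  qed
  then show ?thesis
    by (simp only:) (intro span_sum span_scale span_base, auto)
qed

text \<open>The bound in \<open>T_near\<close> is uniform over functions of a given Lipschitz
  constant, so pointwise closeness of \<open>T n f\<close> to \<open>f\<close> becomes closeness of
  functionals in the dual norm.\<close>

lemma T_adj_tendsto_eval: "(\<lambda>n. blinfun_apply (T_adj n) (lip_eval x)) \<longlonglongrightarrow> lip_eval x"
proof -
  have "\<forall>\<^sub>F n in sequentially. norm (blinfun_apply (T_adj n) (lip_eval x) - lip_eval x) \<le> \<bar>c n x\<bar>"
    using T_near[of x]
  proof eventually_elim
    case (elim n)
    have "\<bar>T n (lip0_apply f) x - lip0_apply f x\<bar> \<le> \<bar>c n x\<bar> * norm f" for f :: "'a lip0"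
    proof -
      have "\<bar>T n (lip0_apply f) x - lip0_apply f x\<bar> \<le> norm f * c n x"
        using elim lip0_lipschitz by blast
      also have "\<dots> \<le> \<bar>c n x\<bar> * norm f"
        by (subst mult.commute) (intro mult_right_mono, auto)
      finally show ?thesis .
    qed
    then show ?case
      by (intro norm_blinfun_bound)
         (auto simp: T_adj_apply blinfun.diff_left lip_eval_apply T_lip0_apply)
  qed
  moreover have "(\<lambda>n. \<bar>c n x\<bar>) \<longlonglongrightarrow> 0"
    using tendsto_rabs[OF c_tendsto[of x]] by simp
  ultimately show ?thesis
    by (rule LIM_zero_cancel[OF Lim_null_comparison])
qed

text \<open>Convergence passes from evaluations to their span by linearity, and to the closure
  because the operators are uniformly bounded by 1.\<close>

lemma T_adj_tendsto:
  assumes "\<mu> \<in> lipschitz_free"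
  shows "(\<lambda>n. blinfun_apply (T_adj n) \<mu>) \<longlonglongrightarrow> \<mu>"
proof (rule LIMSEQ_I)
  fix e :: real assume e: "e > 0"
  have span: "(\<lambda>n. blinfun_apply (T_adj n) \<nu>) \<longlonglongrightarrow> \<nu>" if "\<nu> \<in> span (range lip_eval)" for \<nu>
    using that
  proof (rule span_induct)
    show "subspace {\<nu>. (\<lambda>n. blinfun_apply (T_adj n) \<nu>) \<longlonglongrightarrow> \<nu>}"
      by (auto simp: subspace_def blinfun.add_right blinfun.scaleR_right blinfun.zero_right intro: tendsto_intros)
  qed (auto intro: T_adj_tendsto_eval)
  have "\<exists>\<nu>\<in>span (range lip_eval). dist \<nu> \<mu> < e / 3"
    using assms e unfolding lipschitz_free_def closure_approachable
    by (auto elim!: allE[of _ "e / 3"])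
  then obtain \<nu> where \<nu>: "\<nu> \<in> span (range lip_eval)" "norm (\<mu> - \<nu>) < e / 3"
    by (auto simp: dist_norm norm_minus_commute)
  obtain N where N: "\<And>n. n \<ge> N \<Longrightarrow> norm (blinfun_apply (T_adj n) \<nu> - \<nu>) < e / 3"
    using LIMSEQ_D[OF span[OF \<nu>(1)], of "e / 3"] e by auto
  have "norm (blinfun_apply (T_adj n) \<mu> - \<mu>) < e" if "n \<ge> N" for n
  proof -
    have "blinfun_apply (T_adj n) \<mu> - \<mu>
        = blinfun_apply (T_adj n) (\<mu> - \<nu>) + (blinfun_apply (T_adj n) \<nu> - \<nu>) - (\<mu> - \<nu>)"
      by (simp add: blinfun.diff_right)
    also have "norm \<dots> \<le> norm (blinfun_apply (T_adj n) (\<mu> - \<nu>))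
        + norm (blinfun_apply (T_adj n) \<nu> - \<nu>) + norm (\<mu> - \<nu>)"
      by (intro order_trans[OF norm_triangle_ineq4] add_right_mono norm_triangle_ineq)
    also have "\<dots> < e"
      using N[OF that] \<nu>(2) norm_T_adj_le[of n "\<mu> - \<nu>"] by linarith
    finally show ?thesis .
  qed
  then show "\<exists>N. \<forall>n\<ge>N. norm (blinfun_apply (T_adj n) \<mu> - \<mu>) < e" by blast
qed

theorem admits_monotone_FDD_lipschitz_free:
  assumes "p \<noteq> (0 :: 'a)"
  shows "admits_monotone_FDD (lipschitz_free :: ('a lip0 \<Rightarrow>\<^sub>L real) set)"
proof (rule monotone_FDD_of_commuting_projections[of _ T_adj])
  obtain g :: "'a lip0" where "lip0_apply g p = 1"
    using lip0_bump[of "{p}" p] assms by auto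
  then have "lip_eval p \<noteq> 0"
    using lip_eval_apply[of p g] by auto
  moreover have "lip_eval p \<in> lipschitz_free"
    unfolding lipschitz_free_def by (intro subsetD[OF closure_subset] span_base rangeI)
  ultimately show "lipschitz_free \<noteq> {0 :: 'a lip0 \<Rightarrow>\<^sub>L real}" by blast
  have sub: "span (lip_eval ` G n) \<subseteq> span (range (lip_eval :: 'a \<Rightarrow> _))" for n
    by (intro span_mono) auto
  \<comment> \<open>This holds for every functional in the dual: the range of \<open>T_adj n\<close>
    already lies in a span of evaluations.\<close>
  show "blinfun_apply (T_adj n) \<mu> \<in> lipschitz_free" for n \<mu>
    unfolding lipschitz_free_def by (intro subsetD[OF closure_subset] subsetD[OF sub[of n]] T_adj_in_span)
  show "\<exists>B. finite B \<and> blinfun_apply (T_adj n) ` lipschitz_free \<subseteq> span B" for n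
    using T_adj_in_span finite_G by (intro exI[of _ "lip_eval ` G n"]) auto
qed (rule closed_lipschitz_free subspace_lipschitz_free norm_T_adj_le T_adj_T_adj T_adj_tendsto;
     assumption?)+

end

section \<open>Dyadic interpolation on the real line\<close>

text \<open>The right node is the ceiling and not the floor plus one, so that at the last node of a
  bounded grid no node beyond it is consulted.\<close>

definition lin_interp :: "(int \<Rightarrow> real) \<Rightarrow> real \<Rightarrow> real" where
  "lin_interp g s = (1 - frac s) * g \<lfloor>s\<rfloor> + frac s * g \<lceil>s\<rceil>"

text \<open>The cell is closed at both ends, so estimates on neighbouring cells can be joined at
  their common node.\<close>

lemma lin_interp_cell:
  assumes "of_int k \<le> s" "s \<le> of_int k + 1"
  shows "lin_interp g s = g k + (s - of_int k) * (g (k + 1) - g k)"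
proof -
  consider "s = of_int k" | "s = of_int (k + 1)" | "of_int k < s" "s < of_int (k + 1)"
    using assms by fastforce
  then show ?thesis
  proof cases
    case 3
    then have "\<lfloor>s\<rfloor> = k" "\<lceil>s\<rceil> = k + 1" by linarith+
    then show ?thesis by (simp add: lin_interp_def frac_def algebra_simps)
  qed (simp_all add: lin_interp_def)
qed

lemma lin_interp_of_int: "lin_interp g (of_int k) = g k"
  by (simp add: lin_interp_def)

lemma lin_interp_lipschitz:
  assumes g: "\<And>j k. \<bar>g j - g k\<bar> \<le> K * \<bar>of_int j - of_int k\<bar>"
  shows "\<bar>lin_interp g s - lin_interp g t\<bar> \<le> K * \<bar>s - t\<bar>"
proof -
  have cell: "\<bar>lin_interp g u - lin_interp g v\<bar> \<le> K * \<bar>u - v\<bar>"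
    if "of_int k \<le> u" "u \<le> of_int k + 1" "of_int k \<le> v" "v \<le> of_int k + 1" for u v k
  proof -
    have "lin_interp g u - lin_interp g v = (u - v) * (g (k + 1) - g k)"
      using that by (simp add: lin_interp_cell algebra_simps)
    then have "\<bar>lin_interp g u - lin_interp g v\<bar> = \<bar>u - v\<bar> * \<bar>g (k + 1) - g k\<bar>"
      by (simp add: abs_mult)
    also have "\<dots> \<le> \<bar>u - v\<bar> * K"
      using g[of "k + 1" k] by (intro mult_left_mono) auto
    finally show ?thesis by (simp add: mult.commute)
  qed
  have ordered: "\<bar>lin_interp g u - lin_interp g v\<bar> \<le> K * \<bar>u - v\<bar>" if "u \<le> v" for u v
  proof (cases "v \<le> of_int \<lfloor>u\<rfloor> + 1")
    case True
    then show ?thesis using that by (intro cell[of "\<lfloor>u\<rfloor>"]) linarith+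
  next
    case False
    \<comment> \<open>The way from \<open>u\<close> to \<open>v\<close> goes through the first node
      after \<open>u\<close> and the last node up to \<open>v\<close>; the three lengths add up to
      \<open>v - u\<close>.\<close>
    then have le: "u \<le> of_int (\<lfloor>u\<rfloor> + 1)" "\<lfloor>u\<rfloor> + 1 \<le> \<lfloor>v\<rfloor>" "of_int \<lfloor>v\<rfloor> \<le> v" by linarith+
    have "\<bar>lin_interp g u - g (\<lfloor>u\<rfloor> + 1)\<bar> \<le> K * (of_int (\<lfloor>u\<rfloor> + 1) - u)"
      using cell[of "\<lfloor>u\<rfloor>" u "of_int (\<lfloor>u\<rfloor> + 1)"] le(1) by (simp add: lin_interp_of_int del: of_int_add)
    moreover have "\<bar>g (\<lfloor>u\<rfloor> + 1) - g \<lfloor>v\<rfloor>\<bar> \<le> K * (of_int \<lfloor>v\<rfloor> - of_int (\<lfloor>u\<rfloor> + 1))"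
      using g[of "\<lfloor>u\<rfloor> + 1" "\<lfloor>v\<rfloor>"] le(2) by simp
    moreover have "\<bar>g \<lfloor>v\<rfloor> - lin_interp g v\<bar> \<le> K * (v - of_int \<lfloor>v\<rfloor>)"
      using cell[of "\<lfloor>v\<rfloor>" "of_int \<lfloor>v\<rfloor>" v] le(3) by (simp add: lin_interp_of_int)
    ultimately show ?thesis using that by (simp add: algebra_simps)
  qed
  show ?thesis
    using ordered[of s t] ordered[of t s] by (cases "s \<le> t") (auto simp: abs_minus_commute)
qed

section \<open>Interpolation at dyadic nodes in a bounded interval\<close>

definition clamp_dyadic :: "nat \<Rightarrow> real \<Rightarrow> real" where
  "clamp_dyadic n t = max (- (2 ^ n)) (min (2 ^ n) t)"

definition interp :: "nat \<Rightarrow> (real \<Rightarrow> real) \<Rightarrow> real \<Rightarrow> real" where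
  "interp n \<phi> t = lin_interp (\<lambda>k. \<phi> (of_int k / 2 ^ n)) (2 ^ n * clamp_dyadic n t)"

text \<open>The bound \<open>2 ^ n * 2 ^ n\<close> is the half-length \<open>2 ^ n\<close> of the
  interval divided by the mesh.\<close>

definition dyadic_grid :: "nat \<Rightarrow> real set" where
  "dyadic_grid n = (\<lambda>k. of_int k / 2 ^ n) ` {- (2 ^ n * 2 ^ n)..2 ^ n * 2 ^ n}"

lemma finite_dyadic_grid: "finite (dyadic_grid n)"
  by (simp add: dyadic_grid_def)

lemma zero_in_dyadic_grid: "0 \<in> dyadic_grid n"
  unfolding dyadic_grid_def by (intro image_eqI[of _ _ 0]) auto

lemma dyadic_grid_mono:
  assumes "m \<le> n"
  shows "dyadic_grid m \<subseteq> dyadic_grid n"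
proof
  fix t assume "t \<in> dyadic_grid m"
  then obtain k where k: "t = of_int k / 2 ^ m" "\<bar>k\<bar> \<le> 2 ^ m * 2 ^ m"
    by (force simp: dyadic_grid_def)
  \<comment> \<open>Kept polymorphic because it is used over both the integers and the
    reals.\<close>
  have n: "(2::'a::comm_semiring_1) ^ n = 2 ^ m * 2 ^ (n - m)"
    using assms by (simp flip: power_add)
  have "\<bar>k * 2 ^ (n - m)\<bar> = \<bar>k\<bar> * 2 ^ (n - m)" by (simp add: abs_mult)
  also have "\<dots> \<le> (2 ^ m * 2 ^ m) * (2 ^ (n - m) * 2 ^ (n - m))"
    by (rule mult_mono[OF k(2)]) auto
  also have "\<dots> = 2 ^ n * 2 ^ n" by (simp add: n)
  finally have "k * 2 ^ (n - m) \<in> {- (2 ^ n * 2 ^ n)..2 ^ n * 2 ^ n}" by auto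
  moreover have "t = of_int (k * 2 ^ (n - m)) / 2 ^ n" by (simp add: k(1) n)
  ultimately show "t \<in> dyadic_grid n" unfolding dyadic_grid_def by blast
qed

lemma abs_clamp_dyadic_le: "\<bar>clamp_dyadic n t\<bar> \<le> 2 ^ n"
  using zero_le_power[of "2::real" n] unfolding clamp_dyadic_def by linarith

lemma clamp_dyadic_id: "\<bar>t\<bar> \<le> 2 ^ n \<Longrightarrow> clamp_dyadic n t = t"
  unfolding clamp_dyadic_def by linarith

lemma interp_cong:
  assumes "\<And>s. s \<in> dyadic_grid n \<Longrightarrow> \<phi> s = \<psi> s"
  shows "interp n \<phi> t = interp n \<psi> t"
proof -
  let ?s = "2 ^ n * clamp_dyadic n t"
  have "\<bar>?s\<bar> \<le> real_of_int (2 ^ n * 2 ^ n)"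
    using abs_clamp_dyadic_le[of n t] by (simp add: abs_mult)
  then have "- real_of_int (2 ^ n * 2 ^ n) \<le> ?s" "?s \<le> real_of_int (2 ^ n * 2 ^ n)"
    by linarith+
  then have "\<lfloor>?s\<rfloor> \<in> {- (2 ^ n * 2 ^ n)..2 ^ n * 2 ^ n}" "\<lceil>?s\<rceil> \<in> {- (2 ^ n * 2 ^ n)..2 ^ n * 2 ^ n}"
    by (simp_all only: atLeastAtMost_iff) linarith+
  then have "of_int \<lfloor>?s\<rfloor> / 2 ^ n \<in> dyadic_grid n" "of_int \<lceil>?s\<rceil> / 2 ^ n \<in> dyadic_grid n"
    unfolding dyadic_grid_def by blast+
  then show ?thesis by (simp add: interp_def lin_interp_def assms)
qed

lemma interp_grid:
  assumes "t \<in> dyadic_grid n"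
  shows "interp n \<phi> t = \<phi> t"
proof -
  obtain k where k: "t = of_int k / 2 ^ n" "\<bar>k\<bar> \<le> 2 ^ n * 2 ^ n"
    using assms by (force simp: dyadic_grid_def)
  from k(2) have "\<bar>real_of_int k\<bar> \<le> 2 ^ n * 2 ^ n"
    by (metis (mono_tags) of_int_abs of_int_le_iff of_int_mult of_int_numeral of_int_power)
  then have "\<bar>t\<bar> \<le> 2 ^ n" by (simp add: k(1) divide_le_eq)
  then have "2 ^ n * clamp_dyadic n t = of_int k" by (simp add: clamp_dyadic_id k(1))
  then show ?thesis by (simp add: interp_def lin_interp_def k(1))
qed

lemma interp_const: "interp n (\<lambda>_. c) t = c"
  by (simp add: interp_def lin_interp_def algebra_simps)

lemma interp_add: "interp n (\<lambda>s. \<phi> s + \<psi> s) t = interp n \<phi> t + interp n \<psi> t"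
  by (simp add: interp_def lin_interp_def algebra_simps)

lemma interp_cmult: "interp n (\<lambda>s. c * \<phi> s) t = c * interp n \<phi> t"
  by (simp add: interp_def lin_interp_def algebra_simps)

text \<open>At fixed \<open>n\<close> and \<open>t\<close>, interpolation is a linear combination of
  two point evaluations, so two of them commute as finite sums do.\<close>

lemma interp_swap:
  "interp n (\<lambda>s. interp n (\<lambda>s'. \<phi> s s') t') t = interp n (\<lambda>s'. interp n (\<lambda>s. \<phi> s s') t) t'"
  by (simp add: interp_def lin_interp_def algebra_simps)

lemma abs_convex_combination_le:
  fixes a b c \<theta> :: real
  assumes "0 \<le> \<theta>" "\<theta> \<le> 1" "\<bar>a\<bar> \<le> c" "\<bar>b\<bar> \<le> c"
  shows "\<bar>(1 - \<theta>) * a + \<theta> * b\<bar> \<le> c"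
proof -
  have "\<bar>(1 - \<theta>) * a\<bar> \<le> (1 - \<theta>) * c" "\<bar>\<theta> * b\<bar> \<le> \<theta> * c"
    using assms by (simp_all add: abs_mult mult_left_mono)
  then show ?thesis by (simp add: algebra_simps)
qed

text \<open>The weights are convex, so interpolation contracts the sup norm. In several variables
  this controls the dependence on the coordinates that are not being interpolated.\<close>

lemma interp_diff_le:
  assumes "\<And>s. \<bar>\<phi> s - \<psi> s\<bar> \<le> c"
  shows "\<bar>interp n \<phi> t - interp n \<psi> t\<bar> \<le> c"
proof -
  let ?s = "2 ^ n * clamp_dyadic n t"
  let ?a = "of_int \<lfloor>?s\<rfloor> / 2 ^ n" and ?b = "of_int \<lceil>?s\<rceil> / 2 ^ n"
  have "interp n \<phi> t - interp n \<psi> t = (1 - frac ?s) * (\<phi> ?a - \<psi> ?a) + frac ?s * (\<phi> ?b - \<psi> ?b)"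
    unfolding interp_def lin_interp_def by (simp only: algebra_simps)
  then show ?thesis
    using abs_convex_combination_le[of "frac ?s"] frac_lt_1[of ?s] assms by simp
qed

text \<open>Rescaling the nodes to integers turns \<open>L\<close> into \<open>L / 2 ^ n\<close>,
  rescaling the argument undoes this, and clamping is 1-Lipschitz.\<close>

lemma interp_lipschitz:
  assumes "\<And>s t. \<bar>\<phi> s - \<phi> t\<bar> \<le> L * \<bar>s - t\<bar>"
  shows "\<bar>interp n \<phi> s - interp n \<phi> t\<bar> \<le> L * \<bar>s - t\<bar>"
proof -
  have L: "0 \<le> L" using assms[of 0 1] by simp
  have "\<bar>\<phi> (of_int j / 2 ^ n) - \<phi> (of_int k / 2 ^ n)\<bar> \<le> L / 2 ^ n * \<bar>of_int j - of_int k\<bar>" for j k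
    using assms[of "of_int j / 2 ^ n" "of_int k / 2 ^ n"] by (simp flip: diff_divide_distrib)
  then have "\<bar>interp n \<phi> s - interp n \<phi> t\<bar>
      \<le> L / 2 ^ n * \<bar>2 ^ n * clamp_dyadic n s - 2 ^ n * clamp_dyadic n t\<bar>"
    unfolding interp_def by (rule lin_interp_lipschitz)
  also have "\<dots> = L * \<bar>clamp_dyadic n s - clamp_dyadic n t\<bar>"
    by (simp add: abs_mult flip: right_diff_distrib)
  also have "\<dots> \<le> L * \<bar>s - t\<bar>"
    using L by (intro mult_left_mono) (auto simp: clamp_dyadic_def)
  finally show ?thesis .
qed

lemma interp_near:
  assumes "\<And>s t. \<bar>\<phi> s - \<phi> t\<bar> \<le> L * \<bar>s - t\<bar>" and "\<bar>t\<bar> \<le> 2 ^ n"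
  shows "\<bar>interp n \<phi> t - \<phi> t\<bar> \<le> L / 2 ^ n"
proof -
  have L: "0 \<le> L" using assms(1)[of 0 1] by simp
  let ?s = "2 ^ n * t"
  have c: "clamp_dyadic n t = t" using assms(2) by (rule clamp_dyadic_id)
  have "\<bar>of_int k / 2 ^ n - t\<bar> \<le> 1 / 2 ^ n" if "\<bar>of_int k - ?s\<bar> \<le> 1" for k
    using that by (simp add: field_simps abs_le_iff)
  then have near: "\<bar>\<phi> (of_int k / 2 ^ n) - \<phi> t\<bar> \<le> L / 2 ^ n" if "\<bar>of_int k - ?s\<bar> \<le> 1" for k
    using assms(1)[of "of_int k / 2 ^ n" t] mult_left_mono[OF _ L] that by fastforce
  let ?a = "of_int \<lfloor>?s\<rfloor> / 2 ^ n" and ?b = "of_int \<lceil>?s\<rceil> / 2 ^ n"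
  have "interp n \<phi> t - \<phi> t = (1 - frac ?s) * (\<phi> ?a - \<phi> t) + frac ?s * (\<phi> ?b - \<phi> t)"
    unfolding interp_def lin_interp_def c by (simp add: algebra_simps)
  moreover have "\<bar>\<phi> ?a - \<phi> t\<bar> \<le> L / 2 ^ n" "\<bar>\<phi> ?b - \<phi> t\<bar> \<le> L / 2 ^ n"
    by (rule near; linarith)+
  ultimately show ?thesis
    using abs_convex_combination_le[of "frac ?s"] frac_lt_1[of ?s] by simp
qed

section \<open>Reproduction of coarse interpolants at finer levels\<close>

text \<open>The cells cover the whole line, since an interpolant of level \<open>m\<close> must also
  be recognised at finer levels outside its own interval, where it is constant.\<close>

definition pw_affine :: "nat \<Rightarrow> (real \<Rightarrow> real) \<Rightarrow> bool" where
  "pw_affine n \<psi> \<longleftrightarrow> (\<forall>k::int. \<exists>a b. \<forall>t. of_int k \<le> 2 ^ n * t \<and> 2 ^ n * t \<le> of_int k + 1 \<longrightarrow> \<psi> t = a + b * t)"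

lemma pw_affine_interp: "pw_affine n (interp n \<phi>)"
  unfolding pw_affine_def
proof
  fix k :: int
  define g where "g = (\<lambda>k::int. \<phi> (of_int k / 2 ^ n))"
  define N :: int where "N = 2 ^ n * 2 ^ n"
  have N: "real_of_int N = 2 ^ n * 2 ^ n" by (simp add: N_def)
  have s: "2 ^ n * clamp_dyadic n t = max (- of_int N) (min (of_int N) (2 ^ n * t))" for t
    by (simp add: clamp_dyadic_def N max_mult_distrib_left min_mult_distrib_left)
  \<comment> \<open>In the rescaled variable the clamping bounds are integers, so no cell straddles
    them: it lies in a constant tail or inside the interval.\<close>
  consider "N \<le> k" | "k + 1 \<le> - N" | "- N \<le> k" "k + 1 \<le> N" by linarith
  then show "\<exists>a b. \<forall>t. of_int k \<le> 2 ^ n * t \<and> 2 ^ n * t \<le> of_int k + 1 \<longrightarrow> interp n \<phi> t = a + b * t"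
  proof cases
    case 1
    have "interp n \<phi> t = g N" if "of_int k \<le> 2 ^ n * t" for t
    proof -
      have "2 ^ n * clamp_dyadic n t = of_int N"
        using 1 that N by (simp add: s) (smt (verit) of_int_le_iff zero_le_power mult_nonneg_nonneg)
      then show ?thesis by (simp add: interp_def g_def lin_interp_def)
    qed
    then show ?thesis by (intro exI[of _ "g N"] exI[of _ 0]) simp
  next
    case 2
    have "interp n \<phi> t = g (- N)" if "2 ^ n * t \<le> of_int k + 1" for t
    proof -
      have "2 ^ n * clamp_dyadic n t = of_int (- N)"
        using 2 that N by (simp add: s)
      then show ?thesis by (simp only: interp_def g_def lin_interp_of_int)
    qed
    then show ?thesis by (intro exI[of _ "g (- N)"] exI[of _ 0]) simp
  next
    case 3
    then have 3: "- real_of_int N \<le> of_int k" "real_of_int k + 1 \<le> of_int N"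
      by linarith+
    have "interp n \<phi> t = (g k - of_int k * (g (k + 1) - g k)) + (2 ^ n * (g (k + 1) - g k)) * t"
      if "of_int k \<le> 2 ^ n * t" "2 ^ n * t \<le> of_int k + 1" for t
    proof -
      have "2 ^ n * clamp_dyadic n t = 2 ^ n * t"
        using 3 that by (simp add: s)
      then have "interp n \<phi> t = lin_interp g (2 ^ n * t)"
        by (simp add: interp_def g_def)
      then show ?thesis using that by (simp add: lin_interp_cell algebra_simps)
    qed
    then show ?thesis by blast
  qed
qed

lemma pw_affine_mono:
  assumes "pw_affine m \<psi>" "m \<le> n"
  shows "pw_affine n \<psi>"
  unfolding pw_affine_def
proof
  fix k :: int
  define r :: int where "r = 2 ^ (n - m)"
  have r: "0 < r" by (simp add: r_def)
  have n: "(2::real) ^ n = of_int r * 2 ^ m"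
    using assms(2) by (simp add: r_def flip: power_add)
  \<comment> \<open>\<open>j\<close> is the coarse cell that contains the fine cell
    \<open>k\<close>.\<close>
  define j where "j = k div r"
  have "r * j + k mod r = k" "0 \<le> k mod r" "k mod r < r"
    using r by (simp_all add: j_def)
  then have "r * j \<le> k" "k + 1 \<le> r * (j + 1)"
    by (simp_all add: distrib_left)
  then have j: "of_int r * real_of_int j \<le> of_int k" "real_of_int k + 1 \<le> of_int r * (of_int j + 1)"
    by (metis of_int_le_iff of_int_mult, metis of_int_1 of_int_add of_int_le_iff of_int_mult)
  obtain a b where ab: "\<And>t. of_int j \<le> 2 ^ m * t \<Longrightarrow> 2 ^ m * t \<le> of_int j + 1 \<Longrightarrow> \<psi> t = a + b * t"
    using assms(1) unfolding pw_affine_def by blast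
  have "\<psi> t = a + b * t" if "of_int k \<le> 2 ^ n * t" "2 ^ n * t \<le> of_int k + 1" for t
  proof (rule ab)
    have "of_int r * of_int j \<le> of_int r * (2 ^ m * t)" "of_int r * (2 ^ m * t) \<le> of_int r * (of_int j + 1)"
      using j that by (simp_all add: n mult.assoc)
    then show "of_int j \<le> 2 ^ m * t" "2 ^ m * t \<le> of_int j + 1"
      using r by simp_all
  qed
  then show "\<exists>a b. \<forall>t. of_int k \<le> 2 ^ n * t \<and> 2 ^ n * t \<le> of_int k + 1 \<longrightarrow> \<psi> t = a + b * t"
    by blast
qed

text \<open>An affine function on a cell is recovered from its values at the two ends. Invariance
  under clamping extends this to arguments outside the interval.\<close>

lemma interp_pw_affine:
  assumes "pw_affine n \<psi>" "\<And>t. \<psi> (clamp_dyadic n t) = \<psi> t"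
  shows "interp n \<psi> t = \<psi> t"
proof -
  let ?s = "2 ^ n * clamp_dyadic n t"
  define k where "k = \<lfloor>?s\<rfloor>"
  have k: "of_int k \<le> ?s" "?s \<le> of_int k + 1" unfolding k_def by linarith+
  obtain a b where "\<And>t. of_int k \<le> 2 ^ n * t \<Longrightarrow> 2 ^ n * t \<le> of_int k + 1 \<Longrightarrow> \<psi> t = a + b * t"
    using assms(1) unfolding pw_affine_def by blast
  from this[of "of_int k / 2 ^ n"] this[of "of_int (k + 1) / 2 ^ n"] this[of "clamp_dyadic n t"] k
  have ab: "\<psi> (of_int k / 2 ^ n) = a + b * (of_int k / 2 ^ n)"
    "\<psi> (of_int (k + 1) / 2 ^ n) = a + b * (of_int (k + 1) / 2 ^ n)"
    "\<psi> (clamp_dyadic n t) = a + b * clamp_dyadic n t"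
    by simp_all
  have "interp n \<psi> t = \<psi> (clamp_dyadic n t)"
    unfolding interp_def lin_interp_cell[OF k] ab by (simp add: field_simps)
  then show ?thesis by (simp add: assms(2))
qed

lemma interp_interp:
  assumes "m \<le> n"
  shows "interp n (interp m \<phi>) t = interp m \<phi> t"
proof (rule interp_pw_affine)
  show "pw_affine n (interp m \<phi>)" using pw_affine_interp assms by (rule pw_affine_mono)
  \<comment> \<open>Clamping to the larger interval first does not change the result of clamping to
    the smaller one.\<close>
  have "(2::real) ^ m \<le> 2 ^ n" using assms by simp
  then have "clamp_dyadic m (clamp_dyadic n t) = clamp_dyadic m t" for t
    unfolding clamp_dyadic_def by (smt (verit))
  then show "interp m \<phi> (clamp_dyadic n t) = interp m \<phi> t" for t
    by (simp add: interp_def)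
qed

section \<open>Multi-affine interpolation on \<open>\<ell>\<^sub>1\<close>\<close>

lift_definition unit_l1 :: "'i \<Rightarrow> 'i l1" is "\<lambda>i j. if j = i then 1 else 0"
  by (rule finite_nonzero_values_imp_summable_on) (auto intro: finite_subset[of _ "{_}"] split: if_splits)

lift_definition restrict_l1 :: "'i set \<Rightarrow> 'i l1 \<Rightarrow> 'i l1" is "\<lambda>A x i. if i \<in> A then x i else 0"
  by (rule summable_on_comparison_test) auto

definition upd_l1 :: "'i l1 \<Rightarrow> 'i \<Rightarrow> real \<Rightarrow> 'i l1" where
  "upd_l1 x i t = x + (t - l1_nth x i) *\<^sub>R unit_l1 i"

lemma l1_eqI: "(\<And>i. l1_nth x i = l1_nth y i) \<Longrightarrow> x = y"
  by (simp add: fun_eq_iff flip: l1_nth_inject)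

lemma nth_upd_l1: "l1_nth (upd_l1 x i t) j = (if j = i then t else l1_nth x j)"
  by (simp add: upd_l1_def plus_l1.rep_eq scaleR_l1.rep_eq unit_l1.rep_eq)

lemma norm_restrict_l1: "norm (restrict_l1 A x) = (\<Sum>\<^sub>\<infinity>i\<in>A. \<bar>l1_nth x i\<bar>)"
  unfolding norm_l1.rep_eq restrict_l1.rep_eq by (rule infsum_cong_neutral) auto

lemma norm_restrict_l1_split: "norm x = norm (restrict_l1 A x) + norm (restrict_l1 (- A) x)"
proof -
  have s: "(\<lambda>i. \<bar>l1_nth x i\<bar>) summable_on B" for B
    using l1_nth[of x] by (auto intro: summable_on_subset_banach)
  have "norm x = (\<Sum>\<^sub>\<infinity>i\<in>A \<union> - A. \<bar>l1_nth x i\<bar>)" by (simp add: norm_l1.rep_eq)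
  also have "\<dots> = norm (restrict_l1 A x) + norm (restrict_l1 (- A) x)"
    unfolding norm_restrict_l1 by (rule infsum_Un_disjoint[OF s s]) auto
  finally show ?thesis .
qed

lemma abs_nth_le_norm_l1: "\<bar>l1_nth x i\<bar> \<le> norm x"
  using norm_restrict_l1_split[of x "{i}"] by (simp add: norm_restrict_l1[of "{i}"])

lemma dist_upd_l1: "dist (upd_l1 x i s) (upd_l1 x i t) = \<bar>s - t\<bar>"
proof -
  have "upd_l1 x i s - upd_l1 x i t = (s - t) *\<^sub>R unit_l1 i"
    by (simp add: upd_l1_def algebra_simps)
  moreover have "norm (unit_l1 i :: 'a l1) = 1"
  proof -
    have "unit_l1 i = restrict_l1 {i} (unit_l1 i)"
      by (rule l1_eqI) (simp add: restrict_l1.rep_eq unit_l1.rep_eq)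
    then have "norm (unit_l1 i :: 'a l1) = (\<Sum>\<^sub>\<infinity>j\<in>{i}. \<bar>l1_nth (unit_l1 i) j\<bar>)"
      by (metis norm_restrict_l1)
    then show ?thesis by (simp add: unit_l1.rep_eq)
  qed
  ultimately show ?thesis by (simp add: dist_norm)
qed

text \<open>Equality holds because the norm is additive over disjoint sets of coordinates. This lets
  Lipschitz estimates in coordinate \<open>i\<close> and in the remaining ones be added without
  loss.\<close>

lemma dist_upd_l1_same: "dist (upd_l1 x i t) (upd_l1 y i t) + \<bar>l1_nth x i - l1_nth y i\<bar> = dist x y"
proof -
  have "upd_l1 x i t - upd_l1 y i t = restrict_l1 (- {i}) (x - y)"
    by (rule l1_eqI) (simp add: nth_upd_l1 minus_l1.rep_eq restrict_l1.rep_eq)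
  then show ?thesis
    using norm_restrict_l1_split[of "x - y" "{i}"]
    by (simp add: dist_norm norm_restrict_l1 minus_l1.rep_eq)
qed

lemma dist_restrict_l1_le: "dist (restrict_l1 A x) (restrict_l1 A y) \<le> dist x y"
proof -
  have "restrict_l1 A x - restrict_l1 A y = restrict_l1 A (x - y)"
    by (rule l1_eqI) (simp add: minus_l1.rep_eq restrict_l1.rep_eq)
  then show ?thesis
    using norm_restrict_l1_split[of "x - y" A] by (simp add: dist_norm)
qed

text \<open>Writing the tail as a difference of norms reduces its decay to the convergence of
  partial sums of the norm.\<close>

lemma dist_restrict_l1: "dist (restrict_l1 A x) x = norm x - norm (restrict_l1 A x)"
proof -
  have "restrict_l1 A x - x = - restrict_l1 (- A) x"
    by (rule l1_eqI) (simp add: minus_l1.rep_eq restrict_l1.rep_eq uminus_l1.rep_eq)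
  then show ?thesis
    using norm_restrict_l1_split[of x A] by (simp add: dist_norm)
qed

section \<open>Interpolation in a single coordinate\<close>

text \<open>Interpolating in one coordinate at a time reduces everything to the real line: the operators for
  different coordinates commute, and their product is the multi-affine interpolation.\<close>

definition interp_coord :: "nat \<Rightarrow> 'i \<Rightarrow> ('i l1 \<Rightarrow> real) \<Rightarrow> 'i l1 \<Rightarrow> real" where
  "interp_coord n i f x = interp n (\<lambda>s. f (upd_l1 x i s)) (l1_nth x i)"

lemma upd_l1_self: "upd_l1 x i (l1_nth x i) = x"
  by (simp add: upd_l1_def)

lemma upd_l1_upd_l1: "upd_l1 (upd_l1 x i s) i t = upd_l1 x i t"
  by (rule l1_eqI) (simp add: nth_upd_l1)

lemma upd_l1_swap: "i \<noteq> j \<Longrightarrow> upd_l1 (upd_l1 x i s) j t = upd_l1 (upd_l1 x j t) i s"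
  by (rule l1_eqI) (simp add: nth_upd_l1)

lemma lipschitz_upd_l1:
  assumes "L-lipschitz_on UNIV f"
  shows "\<bar>f (upd_l1 x i s) - f (upd_l1 x i t)\<bar> \<le> L * \<bar>s - t\<bar>"
  using lipschitz_onD[OF assms, of "upd_l1 x i s" "upd_l1 x i t"]
  by (simp add: dist_upd_l1 dist_real_def)

text \<open>Pass from \<open>x\<close> to \<open>y\<close> first in coordinate \<open>i\<close>,
  using \<open>interp_lipschitz\<close>, then in the others, using \<open>interp_diff_le\<close>;
  the two costs sum to \<open>L * dist x y\<close>.\<close>

lemma interp_coord_lipschitz:
  assumes f: "L-lipschitz_on UNIV f"
  shows "L-lipschitz_on UNIV (interp_coord n i f)"
proof (rule lipschitz_onI)
  fix x y :: "'a l1"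
  let ?\<phi> = "\<lambda>x s. f (upd_l1 x i s)"
  have "\<bar>interp n (?\<phi> x) (l1_nth x i) - interp n (?\<phi> x) (l1_nth y i)\<bar> \<le> L * \<bar>l1_nth x i - l1_nth y i\<bar>"
    by (intro interp_lipschitz lipschitz_upd_l1 f)
  moreover have "\<bar>interp n (?\<phi> x) (l1_nth y i) - interp n (?\<phi> y) (l1_nth y i)\<bar>
      \<le> L * (dist x y - \<bar>l1_nth x i - l1_nth y i\<bar>)"
  proof (rule interp_diff_le)
    fix s
    show "\<bar>?\<phi> x s - ?\<phi> y s\<bar> \<le> L * (dist x y - \<bar>l1_nth x i - l1_nth y i\<bar>)"
      using lipschitz_onD[OF f, of "upd_l1 x i s" "upd_l1 y i s"]
      by (simp add: dist_real_def flip: dist_upd_l1_same[of x i s y])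
  qed
  ultimately show "dist (interp_coord n i f x) (interp_coord n i f y) \<le> L * dist x y"
    unfolding interp_coord_def dist_real_def by (simp add: right_diff_distrib)
qed (rule lipschitz_on_nonneg[OF f])

lemma interp_coord_near:
  assumes "L-lipschitz_on UNIV f" "\<bar>l1_nth x i\<bar> \<le> 2 ^ n"
  shows "\<bar>interp_coord n i f x - f x\<bar> \<le> L / 2 ^ n"
  using interp_near[OF lipschitz_upd_l1[OF assms(1)] assms(2), of x i]
  by (simp add: interp_coord_def upd_l1_self)

lemma interp_coord_interp_coord:
  assumes "m \<le> n"
  shows "interp_coord n i (interp_coord m i f) = interp_coord m i f"
  using interp_interp[OF assms]
  by (simp add: interp_coord_def fun_eq_iff nth_upd_l1 upd_l1_upd_l1)

lemma interp_coord_commute: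
  "interp_coord n i (interp_coord n j f) = interp_coord n j (interp_coord n i f)"
proof (cases "i = j")
  case False
  show ?thesis
  proof
    fix x
    show "interp_coord n i (interp_coord n j f) x = interp_coord n j (interp_coord n i f) x"
      using False interp_swap[of n "\<lambda>s s'. f (upd_l1 (upd_l1 x i s) j s')"]
      by (simp add: interp_coord_def nth_upd_l1 upd_l1_swap[of j i])
  qed
qed simp

section \<open>Multi-affine interpolation in finitely many coordinates\<close>

text \<open>A list supplies an order for the product; by \<open>interp_coord_commute\<close> the
  order is immaterial. Restriction is innermost, so \<open>f\<close> is read only at points
  supported on \<open>xs\<close>.\<close>

definition interp_l1 :: "nat \<Rightarrow> 'i list \<Rightarrow> ('i l1 \<Rightarrow> real) \<Rightarrow> 'i l1 \<Rightarrow> real" where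
  "interp_l1 n xs f = foldr (interp_coord n) xs (\<lambda>x. f (restrict_l1 (set xs) x))"

definition grid_l1 :: "nat \<Rightarrow> 'i list \<Rightarrow> 'i l1 set" where
  "grid_l1 n xs = {p. \<forall>i. l1_nth p i \<in> (if i \<in> set xs then dyadic_grid n else {0})}"

lemma foldr_interp_coord_lipschitz:
  "L-lipschitz_on UNIV f \<Longrightarrow> L-lipschitz_on UNIV (foldr (interp_coord n) xs f)"
  by (induction xs) (auto intro: interp_coord_lipschitz)

lemma lipschitz_restrict_l1:
  assumes "L-lipschitz_on UNIV f"
  shows "L-lipschitz_on UNIV (\<lambda>x. f (restrict_l1 A x))"
proof (rule lipschitz_onI)
  fix x y
  have "dist (f (restrict_l1 A x)) (f (restrict_l1 A y)) \<le> L * dist (restrict_l1 A x) (restrict_l1 A y)"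
    using lipschitz_onD[OF assms] by simp
  also have "\<dots> \<le> L * dist x y"
    using lipschitz_on_nonneg[OF assms] by (intro mult_left_mono dist_restrict_l1_le)
  finally show "dist (f (restrict_l1 A x)) (f (restrict_l1 A y)) \<le> L * dist x y" .
qed (rule lipschitz_on_nonneg[OF assms])

lemma interp_l1_lipschitz: "L-lipschitz_on UNIV f \<Longrightarrow> L-lipschitz_on UNIV (interp_l1 n xs f)"
  unfolding interp_l1_def by (intro foldr_interp_coord_lipschitz lipschitz_restrict_l1)

lemma interp_l1_add: "interp_l1 n xs (\<lambda>x. f x + g x) y = interp_l1 n xs f y + interp_l1 n xs g y"
proof -
  have "foldr (interp_coord n) xs (\<lambda>x. f x + g x) y = foldr (interp_coord n) xs f y + foldr (interp_coord n) xs g y"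
    for f g y
    by (induction xs arbitrary: y) (simp_all add: interp_coord_def interp_add)
  then show ?thesis by (simp add: interp_l1_def)
qed

lemma interp_l1_cmult: "interp_l1 n xs (\<lambda>x. r * f x) y = r * interp_l1 n xs f y"
proof -
  have "foldr (interp_coord n) xs (\<lambda>x. r * f x) y = r * foldr (interp_coord n) xs f y" for f y
    by (induction xs arbitrary: y) (simp_all add: interp_coord_def interp_cmult)
  then show ?thesis by (simp add: interp_l1_def)
qed

text \<open>The clause on coordinates outside \<open>xs\<close> carries the induction: the node
  value chosen for the head coordinate must still be known when \<open>f\<close> is finally
  evaluated.\<close>

lemma foldr_interp_coord_cong:
  assumes "\<And>y. (\<And>i. i \<in> set xs \<Longrightarrow> l1_nth y i \<in> dyadic_grid n) \<Longrightarrow>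
    (\<And>i. i \<notin> set xs \<Longrightarrow> l1_nth y i = l1_nth x i) \<Longrightarrow> f y = g y"
  shows "foldr (interp_coord n) xs f x = foldr (interp_coord n) xs g x"
  using assms
proof (induction xs arbitrary: x)
  case Nil
  then show ?case by simp
next
  case (Cons i xs)
  have "foldr (interp_coord n) xs f (upd_l1 x i s) = foldr (interp_coord n) xs g (upd_l1 x i s)"
    if s: "s \<in> dyadic_grid n" for s
  proof (rule Cons.IH)
    fix y
    assume y: "\<And>j. j \<in> set xs \<Longrightarrow> l1_nth y j \<in> dyadic_grid n"
      "\<And>j. j \<notin> set xs \<Longrightarrow> l1_nth y j = l1_nth (upd_l1 x i s) j"
    show "f y = g y"
    proof (rule Cons.prems)
      show "l1_nth y j \<in> dyadic_grid n" if "j \<in> set (i # xs)" for j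
        using that y s by (cases "j \<in> set xs") (auto simp: nth_upd_l1)
      show "l1_nth y j = l1_nth x j" if "j \<notin> set (i # xs)" for j
        using that y(2)[of j] by (simp add: nth_upd_l1)
    qed
  qed
  then show ?case unfolding foldr_Cons o_apply interp_coord_def by (rule interp_cong)
qed

lemma interp_l1_cong:
  assumes "\<And>p. p \<in> grid_l1 n xs \<Longrightarrow> f p = g p"
  shows "interp_l1 n xs f x = interp_l1 n xs g x"
  unfolding interp_l1_def
proof (rule foldr_interp_coord_cong)
  fix y assume "\<And>i. i \<in> set xs \<Longrightarrow> l1_nth y i \<in> dyadic_grid n"
  then have "restrict_l1 (set xs) y \<in> grid_l1 n xs"
    by (simp add: grid_l1_def restrict_l1.rep_eq)
  then show "f (restrict_l1 (set xs) y) = g (restrict_l1 (set xs) y)" by (rule assms)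
qed

lemma interp_l1_on_grid:
  assumes "p \<in> grid_l1 n xs"
  shows "interp_l1 n xs f p = f p"
proof -
  \<comment> \<open>The induction runs over a second list \<open>ys\<close>, because membership of
    \<open>p\<close> in the grid refers to the full list \<open>xs\<close>.\<close>
  have "foldr (interp_coord n) ys g p = g p" if "set ys \<subseteq> set xs" for ys and g :: "'a l1 \<Rightarrow> real"
    using that
  proof (induction ys)
    case (Cons i ys)
    then have "l1_nth p i \<in> dyadic_grid n" using assms by (auto simp: grid_l1_def split: if_splits)
    then show ?case using Cons by (simp add: interp_coord_def interp_grid upd_l1_self)
  qed simp
  moreover have "restrict_l1 (set xs) p = p"
    using assms by (intro l1_eqI) (auto simp: grid_l1_def restrict_l1.rep_eq split: if_splits)
  ultimately show ?thesis by (simp add: interp_l1_def)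
qed

lemma finite_grid_l1: "finite (grid_l1 n xs)"
proof -
  have "finite {f. \<forall>i. (i \<in> set xs \<longrightarrow> f i \<in> dyadic_grid n) \<and> (i \<notin> set xs \<longrightarrow> f i = 0)}"
    by (intro finite_set_of_finite_funs finite_dyadic_grid finite_set)
  moreover have "l1_nth ` grid_l1 n xs
      \<subseteq> {f. \<forall>i. (i \<in> set xs \<longrightarrow> f i \<in> dyadic_grid n) \<and> (i \<notin> set xs \<longrightarrow> f i = 0)}"
    by (auto simp: grid_l1_def split: if_splits)
  ultimately show ?thesis
    by (meson finite_imageD finite_subset inj_onI l1_nth_inject)
qed

lemma grid_l1_mono:
  assumes "m \<le> n" "set xs \<subseteq> set ys"
  shows "grid_l1 m xs \<subseteq> grid_l1 n ys"
  using dyadic_grid_mono[OF assms(1)] zero_in_dyadic_grid[of n] assms(2)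
  by (fastforce simp: grid_l1_def split: if_splits)

text \<open>The extra factor commutes past the others to an occurrence of \<open>i\<close> in the
  list and is absorbed there by idempotence.\<close>

lemma interp_coord_foldr:
  "i \<in> set xs \<Longrightarrow> interp_coord n i (foldr (interp_coord n) xs f) = foldr (interp_coord n) xs f"
proof (induction xs)
  case (Cons j xs)
  then show ?case
    by (cases "i = j") (simp_all add: interp_coord_interp_coord interp_coord_commute[of n i j])
qed simp

lemma interp_l1_depends:
  assumes "\<And>i. i \<in> set xs \<Longrightarrow> l1_nth x i = l1_nth y i"
  shows "interp_l1 n xs f x = interp_l1 n xs f y"
proof -
  let ?g = "\<lambda>x. f (restrict_l1 (set xs) x)"
  have "foldr (interp_coord n) ys ?g x = foldr (interp_coord n) ys ?g y"
    if "set ys \<subseteq> set xs" "\<And>i. i \<in> set xs \<Longrightarrow> l1_nth x i = l1_nth y i" for ys x y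
    using that
  proof (induction ys arbitrary: x y)
    case Nil
    then have "restrict_l1 (set xs) x = restrict_l1 (set xs) y"
      by (intro l1_eqI) (simp add: restrict_l1.rep_eq)
    then show ?case by simp
  next
    case (Cons i ys)
    have "foldr (interp_coord n) ys ?g (upd_l1 x i s) = foldr (interp_coord n) ys ?g (upd_l1 y i s)" for s
      using Cons.prems by (intro Cons.IH) (auto simp: nth_upd_l1)
    moreover have "l1_nth x i = l1_nth y i" using Cons.prems by simp
    ultimately show ?case unfolding foldr_Cons o_apply interp_coord_def[of n i] by (simp only:)
  qed
  from this[OF order_refl assms] show ?thesis by (simp only: interp_l1_def)
qed

lemma interp_l1_interp_l1:
  assumes "m \<le> n" "set xs \<subseteq> set ys"
  shows "interp_l1 n ys (interp_l1 m xs f) = interp_l1 m xs f"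
proof -
  let ?g = "interp_l1 m xs f"
  \<comment> \<open>In an old coordinate \<open>?g\<close> lies in the image of
    \<open>interp_coord m i\<close>, which finer interpolation leaves fixed. In a new coordinate
    \<open>?g\<close> is constant.\<close>
  have fixed: "interp_coord n i ?g = ?g" for i
  proof (cases "i \<in> set xs")
    case True
    then have "interp_coord m i ?g = ?g" by (simp add: interp_l1_def interp_coord_foldr)
    then show ?thesis using interp_coord_interp_coord[OF assms(1)] by metis
  next
    case False
    have "?g (upd_l1 x i s) = ?g x" for x s
      using False by (intro interp_l1_depends) (auto simp: nth_upd_l1)
    then show ?thesis by (simp add: fun_eq_iff interp_coord_def interp_const)
  qed
  have "?g (restrict_l1 (set ys) x) = ?g x" for x
    using assms(2) by (intro interp_l1_depends) (auto simp: restrict_l1.rep_eq)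
  moreover have "foldr (interp_coord n) zs ?g = ?g" for zs
    by (induction zs) (simp_all add: fixed)
  ultimately show ?thesis by (simp add: interp_l1_def[of n])
qed

text \<open>Each coordinate contributes an error of at most \<open>L / 2 ^ n\<close>, and dropping
  the coordinates outside \<open>xs\<close> costs the distance term. The norm bound keeps all
  coordinates of \<open>x\<close> inside the clamping interval.\<close>

lemma interp_l1_near:
  assumes f: "L-lipschitz_on UNIV f" and x: "norm x \<le> 2 ^ n"
  shows "\<bar>interp_l1 n xs f x - f x\<bar> \<le> L * (length xs / 2 ^ n + dist (restrict_l1 (set xs) x) x)"
proof -
  let ?g = "\<lambda>x. f (restrict_l1 (set xs) x)"
  have "\<bar>foldr (interp_coord n) ys ?g x - ?g x\<bar> \<le> L * (length ys / 2 ^ n)" for ys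
  proof (induction ys)
    case (Cons i ys)
    have "L-lipschitz_on UNIV (foldr (interp_coord n) ys ?g)"
      by (intro foldr_interp_coord_lipschitz lipschitz_restrict_l1 f)
    from interp_coord_near[OF this, of x i n] abs_nth_le_norm_l1[of x i] x Cons.IH
    show ?case by (simp add: add_divide_distrib distrib_left)
  qed simp
  from this[of xs] lipschitz_onD[OF f, of "restrict_l1 (set xs) x" x] show ?thesis
    by (simp add: interp_l1_def dist_real_def distrib_left)
qed

section \<open>Convergence along exhausting coordinate sets, and the decompositions\<close>

lemma restrict_l1_tendsto:
  assumes mono: "\<And>m n. m \<le> n \<Longrightarrow> A m \<subseteq> A n" and fin: "\<And>n. finite (A n)"
    and exh: "(\<Union>n. A n) = UNIV"
  shows "(\<lambda>n. dist (restrict_l1 (A n) x) x) \<longlonglongrightarrow> 0"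
proof -
  \<comment> \<open>An increasing exhausting sequence eventually contains each finite set, so the
    unordered sum may be taken along it.\<close>
  have lim: "filterlim A (finite_subsets_at_top UNIV) sequentially"
    unfolding filterlim_finite_subsets_at_top
  proof (intro allI impI)
    fix X :: "'a set" assume "finite X \<and> X \<subseteq> UNIV"
    moreover have "\<forall>\<^sub>F n in sequentially. i \<in> A n" for i
    proof -
      obtain m where "i \<in> A m" using exh by blast
      then show ?thesis using mono unfolding eventually_sequentially by blast
    qed
    ultimately have "\<forall>\<^sub>F n in sequentially. \<forall>i\<in>X. i \<in> A n"
      by (intro eventually_ball_finite) auto
    then show "\<forall>\<^sub>F n in sequentially. finite (A n) \<and> X \<subseteq> A n \<and> A n \<subseteq> UNIV"
      by eventually_elim (use fin in auto)
  qed
  have "((\<lambda>i. \<bar>l1_nth x i\<bar>) has_sum norm x) UNIV"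
    using l1_nth[of x] by (simp add: norm_l1.rep_eq)
  then have "(\<lambda>n. \<Sum>i\<in>A n. \<bar>l1_nth x i\<bar>) \<longlonglongrightarrow> norm x"
    unfolding has_sum_def using lim by (rule filterlim_compose)
  from tendsto_diff[OF tendsto_const[of "norm x"] this] show ?thesis
    by (simp add: dist_restrict_l1 norm_restrict_l1 fin)
qed

text \<open>Since every coordinate adds an error proportional to the mesh, \<open>slow\<close> asks
  that the number of coordinates grow more slowly than \<open>2 ^ n\<close>.\<close>

theorem admits_monotone_FDD_lipschitz_free_l1:
  fixes xs :: "nat \<Rightarrow> 'i list"
  assumes mono: "\<And>m n. m \<le> n \<Longrightarrow> set (xs m) \<subseteq> set (xs n)"
    and exh: "(\<Union>n. set (xs n)) = UNIV"
    and slow: "(\<lambda>n. length (xs n) / 2 ^ n) \<longlonglongrightarrow> 0"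
  shows "admits_monotone_FDD (lipschitz_free :: ('i l1 lip0 \<Rightarrow>\<^sub>L real) set)"
proof -
  interpret lipschitz_projections "\<lambda>n. interp_l1 n (xs n)" "\<lambda>n. grid_l1 n (xs n)"
    "\<lambda>n x. length (xs n) / 2 ^ n + dist (restrict_l1 (set (xs n)) x) x"
  proof
    show "0 \<in> grid_l1 n (xs n)" for n
      by (simp add: grid_l1_def zero_l1.rep_eq zero_in_dyadic_grid)
    show "\<forall>\<^sub>F n in sequentially. \<forall>L f. L-lipschitz_on UNIV f \<longrightarrow> \<bar>interp_l1 n (xs n) f x - f x\<bar>
        \<le> L * (length (xs n) / 2 ^ n + dist (restrict_l1 (set (xs n)) x) x)" for x
    proof -
      obtain N where N: "norm x < 2 ^ N" using real_arch_pow[of 2 "norm x"] by auto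
      have "norm x \<le> 2 ^ n" if "n \<ge> N" for n
        using N power_increasing[OF that, of "2::real"] by linarith
      then show ?thesis
        unfolding eventually_sequentially using interp_l1_near by blast
    qed
    show "(\<lambda>n. length (xs n) / 2 ^ n + dist (restrict_l1 (set (xs n)) x) x) \<longlonglongrightarrow> 0" for x
      using tendsto_add[OF slow restrict_l1_tendsto[of "\<lambda>n. set (xs n)" x]] mono exh by simp
    show "grid_l1 m (xs m) \<subseteq> grid_l1 n (xs n)" if "m \<le> n" for m n
      using that by (intro grid_l1_mono mono)
    show "interp_l1 n (xs n) (interp_l1 m (xs m) f) x = interp_l1 m (xs m) f x" if "m \<le> n" for m n f x
      using that by (simp add: interp_l1_interp_l1 mono)
    show "interp_l1 n (xs n) f x = interp_l1 n (xs n) g x"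
      if "\<And>p. p \<in> grid_l1 n (xs n) \<Longrightarrow> f p = g p" for n f g x
      using that by (rule interp_l1_cong)
  qed (simp_all add: interp_l1_add interp_l1_cmult interp_l1_lipschitz finite_grid_l1 interp_l1_on_grid)
  \<comment> \<open>Index types are inhabited, so \<open>undefined\<close> names a coordinate, and
    its unit vector is a point other than the origin.\<close>
  have "l1_nth (unit_l1 undefined :: 'i l1) undefined \<noteq> l1_nth 0 undefined"
    by (simp add: unit_l1.rep_eq zero_l1.rep_eq)
  then have "unit_l1 undefined \<noteq> (0 :: 'i l1)" by metis
  then show ?thesis by (rule admits_monotone_FDD_lipschitz_free)
qed

theorem theorem3p1:
  shows "admits_monotone_FDD (lipschitz_free :: (nat l1 lip0 \<Rightarrow>\<^sub>L real) set) \<and>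
         admits_monotone_FDD (lipschitz_free :: ('n::finite l1 lip0 \<Rightarrow>\<^sub>L real) set)"
proof
  \<comment> \<open>Level \<open>n\<close> uses the first \<open>n\<close> coordinates.\<close>
  have "(\<lambda>n. real n / 2 ^ n) \<longlonglongrightarrow> 0"
    using lim_n_over_pown[of "2::real"] by simp
  then show "admits_monotone_FDD (lipschitz_free :: (nat l1 lip0 \<Rightarrow>\<^sub>L real) set)"
    by (intro admits_monotone_FDD_lipschitz_free_l1[of "\<lambda>n. [0..<n]"]) (auto intro: lessI)
  \<comment> \<open>With finitely many coordinates all of them are used at every level, and only the
    mesh and the cube change.\<close>
  obtain ys :: "'n list" where "set ys = UNIV"
    using finite_list[of "UNIV :: 'n set"] by auto
  then show "admits_monotone_FDD (lipschitz_free :: ('n::finite l1 lip0 \<Rightarrow>\<^sub>L real) set)"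
    by (intro admits_monotone_FDD_lipschitz_free_l1[of "\<lambda>_. ys"])
       (auto intro: LIMSEQ_divide_realpow_zero)
qed

end
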